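(* Let $\varphi_{(\alpha,q_o)}$ be the OT-ruled surface of a curve $\alpha$ with angle function $\theta$, and let $\eta=\theta'+\kappa$, $\mu=\tau\sin\theta$, $\xi=\tau\cos\theta$, $f=\sin\theta-u\eta$, $g=u\mu$. (i) The OT-ruled surface $\varphi_{(\alpha,q_o)}$ is minimal if and only if the equality $$(f^2+g^2)\xi+\mu\sin\theta\cos\theta+g^2\left(\frac{f}{g}\right)_{s}=0$$ is satisfied. (ii) If $\tau\neq 0$, there is no minimal tangent surface $\varphi_{(\alpha,T)}$. (iii) The principal normal surface $\varphi_{(\alpha,N)}$ is minimal if and only if $fu\mu'-gf_s=0$, where $f_s=\partial f/\partial s$.
   Context: Let $\alpha:I\to\mathbb{R}^3$ ($I\subset\mathbb{R}$ an open interval) be a smooth curve with arc-length parameter $s$, curvature $\kappa$, torsion $\tau$ and Frenet frame $\{\vec T,\vec N,\vec B\}$, so $\vec T'=\kappa\vec N$, $\vec N'=-\kappa\vec T+\tau\vec B$, $\vec B'=-\tau\vec N$. Let $\theta:I\to\mathbb{R}$ be a $C^\infty$ function and $\vec q_o(s)=\cos\theta(s)\,\vec T(s)+\sin\theta(s)\,\vec N(s)$. The osculating-type (OT)-ruled surface of $\alpha$ is $\vec\varphi_{(\alpha,q_o)}(s,u)=\vec\alpha(s)+u\,\vec q_o(s)$, $(s,u)\in I\times\mathbb{R}$. The tangent surface $\varphi_{(\alpha,T)}$ is the case $\theta(s)=k\pi$ for all $s$ with some $k\in\mathbb{Z}$ (then $\alpha$ is always assumed not to be a straight line, i.e. $\kappa\neq0$),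 and the principal normal surface $\varphi_{(\alpha,N)}$ is the case $\theta(s)=\pi/2+k\pi$ for all $s$ with some $k\in\mathbb{Z}$. The functions $f,g$ depend on $(s,u)$; the subscript $s$ denotes $\partial/\partial s$, and $g^2(f/g)_s$ stands for $g f_s-f g_s$. A surface is minimal if its mean curvature vanishes at all (regular) points. *)

theory Defs
  imports "HOL-Analysis.Analysis"
begin

(* All derivatives are two-sided, so this is meant for open sets I; iterating the total operator
   vector_derivative is harmless there, since the previous iterates are differentiable on all of I. *)
definition smooth_on_open :: "real set \<Rightarrow> (real \<Rightarrow> 'a::real_normed_vector) \<Rightarrow> bool" where
  "smooth_on_open I h \<longleftrightarrow> open I \<and>
     (\<forall>n. \<forall>t\<in>I. ((\<lambda>g x. vector_derivative g (at x)) ^^ n) h differentiable (at t))"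

(* The frame is part of the data, and kappa may vanish, so that straight lines are not excluded.
   Where kappa > 0, the conditions determine everything from alpha: T = alpha',
   kappa = norm T', N = T' / kappa, and tau from N' and B. *)
definition frenet_curve ::
  "real set \<Rightarrow> (real \<Rightarrow> real^3) \<Rightarrow> (real \<Rightarrow> real^3) \<Rightarrow> (real \<Rightarrow> real^3) \<Rightarrow> (real \<Rightarrow> real^3)
    \<Rightarrow> (real \<Rightarrow> real) \<Rightarrow> (real \<Rightarrow> real) \<Rightarrow> bool" where
  "frenet_curve I \<alpha> T N B \<kappa> \<tau> \<longleftrightarrow>
     open I \<and> is_interval I \<and> I \<noteq> {} \<and>
     smooth_on_open I \<alpha> \<and> smooth_on_open I T \<and> smooth_on_open I N \<and> smooth_on_open I B \<and>
     smooth_on_open I \<kappa> \<and> smooth_on_open I \<tau> \<and>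
     (\<forall>s\<in>I. (\<alpha> has_vector_derivative T s) (at s) \<and>
        norm (T s) = 1 \<and> norm (N s) = 1 \<and> T s \<bullet> N s = 0 \<and> B s = cross3 (T s) (N s) \<and>
        \<kappa> s \<ge> 0 \<and>
        (T has_vector_derivative \<kappa> s *\<^sub>R N s) (at s) \<and>
        (N has_vector_derivative (- \<kappa> s) *\<^sub>R T s + \<tau> s *\<^sub>R B s) (at s) \<and>
        (B has_vector_derivative (- \<tau> s) *\<^sub>R N s) (at s))"

definition partial_s :: "(real \<Rightarrow> real \<Rightarrow> real^3) \<Rightarrow> real \<Rightarrow> real \<Rightarrow> real^3" where
  "partial_s \<phi> s u = vector_derivative (\<lambda>t. \<phi> t u) (at s)"

definition partial_u :: "(real \<Rightarrow> real \<Rightarrow> real^3) \<Rightarrow> real \<Rightarrow> real \<Rightarrow> real^3" where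
  "partial_u \<phi> s u = vector_derivative (\<lambda>v. \<phi> s v) (at u)"

definition regular_point :: "(real \<Rightarrow> real \<Rightarrow> real^3) \<Rightarrow> real \<Rightarrow> real \<Rightarrow> bool" where
  "regular_point \<phi> s u \<longleftrightarrow> cross3 (partial_s \<phi> s u) (partial_u \<phi> s u) \<noteq> 0"

definition unit_normal :: "(real \<Rightarrow> real \<Rightarrow> real^3) \<Rightarrow> real \<Rightarrow> real \<Rightarrow> real^3" where
  "unit_normal \<phi> s u =
     (let n = cross3 (partial_s \<phi> s u) (partial_u \<phi> s u) in n /\<^sub>R norm n)"

(* H = (E N - 2 F M + G L) / (2 (E G - F^2)); meaningful at regular points only. *)
definition mean_curvature :: "(real \<Rightarrow> real \<Rightarrow> real^3) \<Rightarrow> real \<Rightarrow> real \<Rightarrow> real" where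
  "mean_curvature \<phi> s u =
     (let E = partial_s \<phi> s u \<bullet> partial_s \<phi> s u;
          F = partial_s \<phi> s u \<bullet> partial_u \<phi> s u;
          G = partial_u \<phi> s u \<bullet> partial_u \<phi> s u;
          L = partial_s (partial_s \<phi>) s u \<bullet> unit_normal \<phi> s u;
          M = partial_u (partial_s \<phi>) s u \<bullet> unit_normal \<phi> s u;
          N = partial_u (partial_u \<phi>) s u \<bullet> unit_normal \<phi> s u
      in (E * N - 2 * F * M + G * L) / (2 * (E * G - F\<^sup>2)))"

definition minimal_on :: "(real \<times> real) set \<Rightarrow> (real \<Rightarrow> real \<Rightarrow> real^3) \<Rightarrow> bool" where
  "minimal_on D \<phi> \<longleftrightarrow>
     (\<forall>(s, u)\<in>D. regular_point \<phi> s u \<longrightarrow> mean_curvature \<phi> s u = 0)"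

definition OT_surface ::
  "(real \<Rightarrow> real^3) \<Rightarrow> (real \<Rightarrow> real^3) \<Rightarrow> (real \<Rightarrow> real^3) \<Rightarrow> (real \<Rightarrow> real)
    \<Rightarrow> real \<Rightarrow> real \<Rightarrow> real^3" where
  "OT_surface \<alpha> T N \<theta> s u = \<alpha> s + u *\<^sub>R (cos (\<theta> s) *\<^sub>R T s + sin (\<theta> s) *\<^sub>R N s)"

end

theory Submission
  imports Defs
begin

text \<open>
  Everything is computed in coordinates with respect to the Frenet frame. With
  \<open>f = sin \<theta> - u \<eta>\<close> and \<open>g = u \<mu>\<close> the unnormalised normal \<open>\<phi>\<^sub>s \<times> \<phi>\<^sub>u\<close> of the surface
  \<open>\<phi> s u = \<alpha> s + u q s\<close> is \<open>(- g sin \<theta>, g cos \<theta>, f)\<close>, so its squared norm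
  \<open>E G - F\<^sup>2\<close> is \<open>f\<^sup>2 + g\<^sup>2\<close> (lemmas \<open>normal_fr\<close> and \<open>norm_normal\<close>). Rulings are straight unit
  speed lines, so \<open>\<phi>\<^sub>u\<^sub>u = 0\<close> and \<open>G = 1\<close>; together with \<open>F = cos \<theta>\<close> the numerator of the mean
  curvature shrinks to \<open>L - 2 cos \<theta> M\<close>. The products of \<open>\<phi>\<^sub>s\<^sub>u\<close> and \<open>\<phi>\<^sub>s\<^sub>s\<close> with the normal show that this
  is, up to the factor \<open>sqrt (f\<^sup>2 + g\<^sup>2)\<close>, the negative of
  \<open>(f\<^sup>2 + g\<^sup>2) \<xi> + \<mu> sin \<theta> cos \<theta> + g f\<^sub>s - f g\<^sub>s\<close>, called the minimality defect below
  (lemma \<open>mean_curvature_OT\<close>).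

  Minimality therefore says that the defect vanishes at the regular points, whereas the
  theorem asks for its vanishing at every parameter. The two agree because the defect is
  automatically zero at singular points: there \<open>f = g = 0\<close>, and \<open>g = u \<mu> = 0\<close> forces either
  \<open>\<mu> = 0\<close>, or \<open>u = 0\<close> and then \<open>sin \<theta> = f = 0\<close>, so that the remaining term
  \<open>\<mu> sin \<theta> cos \<theta>\<close> is zero as well (lemma \<open>minimality_defect_singular\<close>).

  The other two parts evaluate the defect. If \<open>sin \<theta> = 0\<close> throughout, it is
  \<open>(u \<kappa>)\<^sup>2 \<xi>\<close> with \<open>\<xi> = \<tau>\<close> or \<open>\<xi> = - \<tau>\<close>, which is nonzero at \<open>u = 1\<close> wherever
  \<open>\<kappa> \<tau> \<noteq> 0\<close>. If \<open>cos \<theta> = 0\<close>, only \<open>g f\<^sub>s - f g\<^sub>s\<close> survives, and \<open>g\<^sub>s = u \<mu>'\<close>.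
\<close>

section \<open>Calculus in an orthonormal moving frame\<close>

definition frame_vec :: "real^3 \<Rightarrow> real^3 \<Rightarrow> real^3 \<Rightarrow> real \<Rightarrow> real \<Rightarrow> real \<Rightarrow> real^3" where
  "frame_vec T N B a b c = a *\<^sub>R T + b *\<^sub>R N + c *\<^sub>R B"

text \<open>Rewriting with this table reduces inner products in the frame to coordinates; the
  third entry is Lagrange's identity.\<close>
lemma frame_inner_table:
  fixes T N :: "real^3"
  assumes "norm T = 1" "norm N = 1" "T \<bullet> N = 0"
  shows "T \<bullet> T = 1" "N \<bullet> N = 1" "cross3 T N \<bullet> cross3 T N = 1"
    "T \<bullet> N = 0" "N \<bullet> T = 0" "T \<bullet> cross3 T N = 0" "cross3 T N \<bullet> T = 0"
    "N \<bullet> cross3 T N = 0" "cross3 T N \<bullet> N = 0"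
proof -
  show TT: "T \<bullet> T = 1" and NN: "N \<bullet> N = 1" and "T \<bullet> N = 0" "N \<bullet> T = 0"
    using assms by (simp_all add: dot_square_norm inner_commute)
  have "(norm (cross3 T N))\<^sup>2 = 1"
    using norm_cross_dot[of T N] assms by simp
  then show "cross3 T N \<bullet> cross3 T N = 1"
    by (simp add: dot_square_norm)
qed (simp_all add: dot_cross_self)

lemma inner_frame_vec:
  fixes T N :: "real^3"
  assumes "norm T = 1" "norm N = 1" "T \<bullet> N = 0"
  shows "frame_vec T N (cross3 T N) a b c \<bullet> frame_vec T N (cross3 T N) a' b' c'
    = a * a' + b * b' + c * c'"
  by (simp add: frame_vec_def inner_add_left inner_add_right frame_inner_table[OF assms])

lemma cross3_frame_vec:
  fixes T N :: "real^3"
  assumes "norm T = 1" "norm N = 1" "T \<bullet> N = 0"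
  shows "cross3 (frame_vec T N (cross3 T N) a b c) (frame_vec T N (cross3 T N) a' b' c')
    = frame_vec T N (cross3 T N) (b * c' - c * b') (c * a' - a * c') (a * b' - b * a')"
proof -
  note tab = frame_inner_table[OF assms]
  have NT: "cross3 N T = - cross3 T N" by (rule cross_skew)
  have TB: "cross3 T (cross3 T N) = - N"
    using Lagrange[of T T N] tab by simp
  have NB: "cross3 N (cross3 T N) = T"
    using Lagrange[of N T N] tab by simp
  have BT: "cross3 (cross3 T N) T = N"
    by (subst cross_skew) (simp add: TB)
  have BN: "cross3 (cross3 T N) N = - T"
    by (subst cross_skew) (simp add: NB)
  show ?thesis
    \<comment> \<open>The rest is bilinearity, given that \<open>(T, N, T \<times> N)\<close> is positively oriented.\<close>
    by (simp add: frame_vec_def cross_add_left cross_add_right cross_mult_left cross_mult_right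
        TB NB BT BN NT algebra_simps)
qed

text \<open>The covariant form of the product rule: besides the derivatives of the coordinates there
  is the contribution of the rotating frame, given by the skew-symmetric Frenet matrix. It turns
  each further \<open>s\<close>-derivative of the surface into a computation with three scalar functions.\<close>
lemma frenet_frame_vec_derivative:
  assumes curve: "frenet_curve I \<alpha> T N B \<kappa> \<tau>" and s: "s \<in> I"
    and a: "(a has_real_derivative a') (at s)"
    and b: "(b has_real_derivative b') (at s)"
    and c: "(c has_real_derivative c') (at s)"
  shows "((\<lambda>t. frame_vec (T t) (N t) (B t) (a t) (b t) (c t)) has_vector_derivative
      frame_vec (T s) (N s) (B s)
        (a' - \<kappa> s * b s) (b' + \<kappa> s * a s - \<tau> s * c s) (c' + \<tau> s * b s)) (at s)"
proof -
  have T: "(T has_vector_derivative \<kappa> s *\<^sub>R N s) (at s)"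
    and N: "(N has_vector_derivative (- \<kappa> s) *\<^sub>R T s + \<tau> s *\<^sub>R B s) (at s)"
    and B: "(B has_vector_derivative (- \<tau> s) *\<^sub>R N s) (at s)"
    using curve s unfolding frenet_curve_def by blast+
  show ?thesis
    unfolding frame_vec_def
    by (rule has_vector_derivative_eq_rhs,
        (rule has_vector_derivative_add has_vector_derivative_scaleR a b c T N B)+)
      (simp add: algebra_simps)
qed

section \<open>The fundamental forms of an OT-ruled surface\<close>

locale OT_ruled =
  fixes I :: "real set"
    and \<alpha> T N B :: "real \<Rightarrow> real^3"
    and \<kappa> \<tau> \<theta> \<eta> \<mu> \<xi> :: "real \<Rightarrow> real"
    and f g :: "real \<Rightarrow> real \<Rightarrow> real"
  assumes curve: "frenet_curve I \<alpha> T N B \<kappa> \<tau>"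
    and theta: "smooth_on_open I \<theta>"
    and eta: "\<eta> = (\<lambda>s. deriv \<theta> s + \<kappa> s)"
    and mu: "\<mu> = (\<lambda>s. \<tau> s * sin (\<theta> s))"
    and xi: "\<xi> = (\<lambda>s. \<tau> s * cos (\<theta> s))"
    and f: "f = (\<lambda>s u. sin (\<theta> s) - u * \<eta> s)"
    and g: "g = (\<lambda>s u. u * \<mu> s)"
begin

abbreviation \<phi> :: "real \<Rightarrow> real \<Rightarrow> real^3" where
  "\<phi> \<equiv> OT_surface \<alpha> T N \<theta>"

abbreviation fr :: "real \<Rightarrow> real \<Rightarrow> real \<Rightarrow> real \<Rightarrow> real^3" where
  "fr s \<equiv> frame_vec (T s) (N s) (B s)"

text \<open>The left-hand side of the minimality equation, where \<open>g\<^sup>2 (f / g)\<^sub>s\<close> is written as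
  \<open>g f\<^sub>s - f g\<^sub>s\<close> in order to make sense at zeros of \<open>g\<close>.\<close>
definition minimality_defect :: "real \<Rightarrow> real \<Rightarrow> real" where
  "minimality_defect s u =
     ((f s u)\<^sup>2 + (g s u)\<^sup>2) * \<xi> s + \<mu> s * sin (\<theta> s) * cos (\<theta> s)
       + (g s u * deriv (\<lambda>t. f t u) s - f s u * deriv (\<lambda>t. g t u) s)"

lemma open_I: "open I"
  using curve unfolding frenet_curve_def by blast

lemma B_eq: "s \<in> I \<Longrightarrow> B s = cross3 (T s) (N s)"
  and frame_orthonormal: "s \<in> I \<Longrightarrow> norm (T s) = 1" "s \<in> I \<Longrightarrow> norm (N s) = 1"
    "s \<in> I \<Longrightarrow> T s \<bullet> N s = 0"
  using curve unfolding frenet_curve_def by blast+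

lemma inner_fr: "s \<in> I \<Longrightarrow> fr s a b c \<bullet> fr s a' b' c' = a * a' + b * b' + c * c'"
  using inner_frame_vec[OF frame_orthonormal] by (simp add: B_eq)

lemma cross3_fr: "s \<in> I \<Longrightarrow> cross3 (fr s a b c) (fr s a' b' c')
    = fr s (b * c' - c * b') (c * a' - a * c') (a * b' - b * a')"
  using cross3_frame_vec[OF frame_orthonormal] by (simp add: B_eq)

end

lemma smooth_on_open_real_derivatives:
  fixes h :: "real \<Rightarrow> real"
  assumes "smooth_on_open I h" "s \<in> I"
  shows "(h has_real_derivative deriv h s) (at s)"
    "(deriv h has_real_derivative deriv (deriv h) s) (at s)"
proof -
  have vd: "(\<lambda>x. vector_derivative h (at x)) = deriv h"
    by (rule ext, metis field_derivative_eq_vector_derivative)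
  have d: "\<And>n. ((\<lambda>g x. vector_derivative g (at x)) ^^ n) h differentiable (at s)"
    using assms unfolding smooth_on_open_def by blast
  show "(h has_real_derivative deriv h s) (at s)"
    using d[of 0] by (simp add: DERIV_deriv_iff_real_differentiable)
  show "(deriv h has_real_derivative deriv (deriv h) s) (at s)"
    using d[of 1] by (simp add: DERIV_deriv_iff_real_differentiable vd)
qed

context OT_ruled
begin

lemma theta_deriv: "s \<in> I \<Longrightarrow> (\<theta> has_real_derivative deriv \<theta> s) (at s)"
  by (rule smooth_on_open_real_derivatives[OF theta])

lemma eta_deriv: "s \<in> I \<Longrightarrow> (\<eta> has_real_derivative deriv \<eta> s) (at s)"
proof -
  assume s: "s \<in> I"
  have "smooth_on_open I \<kappa>" using curve unfolding frenet_curve_def by blast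
  from smooth_on_open_real_derivatives(1)[OF this s] smooth_on_open_real_derivatives(2)[OF theta s]
  have "(\<eta> has_real_derivative deriv (deriv \<theta>) s + deriv \<kappa> s) (at s)"
    unfolding eta by (intro DERIV_add)
  then show ?thesis by (simp add: DERIV_imp_deriv)
qed

lemma mu_deriv: "s \<in> I \<Longrightarrow> (\<mu> has_real_derivative deriv \<mu> s) (at s)"
  and mu_deriv_eq: "s \<in> I \<Longrightarrow> deriv \<mu> s = deriv \<tau> s * sin (\<theta> s) + \<xi> s * deriv \<theta> s"
proof -
  assume s: "s \<in> I"
  have "smooth_on_open I \<tau>" using curve unfolding frenet_curve_def by blast
  from smooth_on_open_real_derivatives(1)[OF this s]
  have *: "(\<mu> has_real_derivative deriv \<tau> s * sin (\<theta> s) + \<xi> s * deriv \<theta> s) (at s)"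
    unfolding mu xi by (auto intro!: derivative_eq_intros theta_deriv s)
  show "deriv \<mu> s = deriv \<tau> s * sin (\<theta> s) + \<xi> s * deriv \<theta> s"
    by (rule DERIV_imp_deriv[OF *])
  with * show "(\<mu> has_real_derivative deriv \<mu> s) (at s)" by simp
qed

lemma f_s: "s \<in> I \<Longrightarrow> deriv (\<lambda>t. f t u) s = cos (\<theta> s) * deriv \<theta> s - u * deriv \<eta> s"
  unfolding f by (rule DERIV_imp_deriv) (auto intro!: derivative_eq_intros theta_deriv eta_deriv)

lemma g_s: "s \<in> I \<Longrightarrow> deriv (\<lambda>t. g t u) s = u * deriv \<mu> s"
  unfolding g by (rule DERIV_imp_deriv) (auto intro!: derivative_eq_intros mu_deriv)

lemma director_fr: "cos (\<theta> s) *\<^sub>R T s + sin (\<theta> s) *\<^sub>R N s = fr s (cos (\<theta> s)) (sin (\<theta> s)) 0"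
  by (simp add: frame_vec_def)

lemma phi_u: "partial_u \<phi> s u = fr s (cos (\<theta> s)) (sin (\<theta> s)) 0"
  unfolding partial_u_def OT_surface_def director_fr
  by (rule vector_derivative_at) (auto intro!: derivative_eq_intros)

lemma phi_uu: "partial_u (partial_u \<phi>) s u = 0"
  unfolding partial_u_def[of "partial_u \<phi>"] phi_u by simp

lemma phi_s:
  assumes s: "s \<in> I"
  shows "partial_s \<phi> s u
    = fr s (1 - u * (\<eta> s * sin (\<theta> s))) (u * (\<eta> s * cos (\<theta> s))) (u * \<mu> s)"
proof -
  have A: "(\<alpha> has_vector_derivative T s) (at s)"
    using curve s unfolding frenet_curve_def by blast
  have "((\<lambda>t. fr t (cos (\<theta> t)) (sin (\<theta> t)) 0) has_vector_derivative
      fr s (- sin (\<theta> s) * deriv \<theta> s - \<kappa> s * sin (\<theta> s))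
           (cos (\<theta> s) * deriv \<theta> s + \<kappa> s * cos (\<theta> s) - \<tau> s * 0)
           (0 + \<tau> s * sin (\<theta> s))) (at s)"
    by (rule frenet_frame_vec_derivative[OF curve s])
      (auto intro!: derivative_eq_intros theta_deriv s)
  from has_vector_derivative_add[OF A has_vector_derivative_scaleR[OF DERIV_const[of u] this]]
  show ?thesis
    unfolding partial_s_def OT_surface_def director_fr
    by (intro vector_derivative_at, elim has_vector_derivative_eq_rhs)
      (simp add: frame_vec_def mu eta algebra_simps)
qed

lemma phi_us:
  assumes s: "s \<in> I"
  shows "partial_u (partial_s \<phi>) s u
    = fr s (- (\<eta> s * sin (\<theta> s))) (\<eta> s * cos (\<theta> s)) (\<mu> s)"
  unfolding partial_u_def[of "partial_s \<phi>"] phi_s[OF s] frame_vec_def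
  by (rule vector_derivative_at) (auto intro!: derivative_eq_intros simp: algebra_simps)

text \<open>Since \<open>\<phi>\<^sub>s\<close> is itself given by frame coordinates along the whole open interval, the Frenet
  product rule applies to it a second time.\<close>
lemma phi_ss:
  assumes s: "s \<in> I"
  shows "partial_s (partial_s \<phi>) s u
    = fr s (- u * (deriv \<eta> s * sin (\<theta> s) + \<eta> s * cos (\<theta> s) * deriv \<theta> s)
              - \<kappa> s * (u * (\<eta> s * cos (\<theta> s))))
           (u * (deriv \<eta> s * cos (\<theta> s) - \<eta> s * sin (\<theta> s) * deriv \<theta> s)
              + \<kappa> s * (1 - u * (\<eta> s * sin (\<theta> s))) - \<tau> s * (u * \<mu> s))
           (u * deriv \<mu> s + \<tau> s * (u * (\<eta> s * cos (\<theta> s))))"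
    (is "_ = ?rhs")
proof -
  have "((\<lambda>t. fr t (1 - u * (\<eta> t * sin (\<theta> t))) (u * (\<eta> t * cos (\<theta> t))) (u * \<mu> t))
      has_vector_derivative ?rhs) (at s)"
    by (rule frenet_frame_vec_derivative[OF curve s])
      (auto intro!: derivative_eq_intros theta_deriv eta_deriv mu_deriv s simp: algebra_simps)
  then have "((\<lambda>t. partial_s \<phi> t u) has_vector_derivative ?rhs) (at s)"
    by (rule has_vector_derivative_transform_within_open[OF _ open_I s]) (simp add: phi_s)
  then show ?thesis
    unfolding partial_s_def[of "partial_s \<phi>"] by (rule vector_derivative_at)
qed

text \<open>The functions \<open>f\<close> and \<open>g\<close> are the coordinates of the normal: the vector
  \<open>(- sin \<theta>, cos \<theta>, 0)\<close> completes the ruling direction to an orthonormal basis of the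
  osculating plane, and the normal is \<open>g\<close> times it plus \<open>f B\<close>.\<close>
lemma normal_fr:
  assumes s: "s \<in> I"
  shows "cross3 (partial_s \<phi> s u) (partial_u \<phi> s u)
    = fr s (- (g s u * sin (\<theta> s))) (g s u * cos (\<theta> s)) (f s u)"
proof -
  have "(1 - u * (\<eta> s * sin (\<theta> s))) * sin (\<theta> s) - u * (\<eta> s * cos (\<theta> s)) * cos (\<theta> s)
      = sin (\<theta> s) - u * \<eta> s"
    using sin_cos_squared_add[of "\<theta> s"] by algebra
  then show ?thesis
    by (simp add: phi_s phi_u cross3_fr s f g)
qed

lemma norm_normal:
  assumes s: "s \<in> I"
  shows "(norm (cross3 (partial_s \<phi> s u) (partial_u \<phi> s u)))\<^sup>2 = (f s u)\<^sup>2 + (g s u)\<^sup>2"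
proof -
  have "g s u * sin (\<theta> s) * (g s u * sin (\<theta> s)) + g s u * cos (\<theta> s) * (g s u * cos (\<theta> s))
      = (g s u)\<^sup>2"
    using sin_cos_squared_add[of "\<theta> s"] by algebra
  then show ?thesis
    by (simp add: normal_fr s inner_fr flip: dot_square_norm) (simp add: power2_eq_square)
qed

lemma regular_iff:
  assumes s: "s \<in> I"
  shows "regular_point \<phi> s u \<longleftrightarrow> f s u \<noteq> 0 \<or> g s u \<noteq> 0"
proof -
  have "regular_point \<phi> s u \<longleftrightarrow> (norm (cross3 (partial_s \<phi> s u) (partial_u \<phi> s u)))\<^sup>2 \<noteq> 0"
    by (simp add: regular_point_def)
  then show ?thesis by (simp add: norm_normal s sum_power2_eq_zero_iff)
qed

lemma inner_phi_s_phi_u: "s \<in> I \<Longrightarrow> partial_s \<phi> s u \<bullet> partial_u \<phi> s u = cos (\<theta> s)"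
  by (simp add: phi_s phi_u inner_fr algebra_simps)

lemma inner_phi_u_phi_u: "s \<in> I \<Longrightarrow> partial_u \<phi> s u \<bullet> partial_u \<phi> s u = 1"
  by (simp add: phi_u inner_fr flip: power2_eq_square)

text \<open>Expanding by the previous lemmas gives \<open>\<eta> g + \<mu> f\<close>, and in this sum the two
  terms \<open>u \<eta> \<mu>\<close> cancel, so that the product is constant along each ruling.\<close>
lemma phi_us_normal:
  assumes s: "s \<in> I"
  shows "partial_u (partial_s \<phi>) s u \<bullet> cross3 (partial_s \<phi> s u) (partial_u \<phi> s u)
    = \<mu> s * sin (\<theta> s)"
proof -
  have "partial_u (partial_s \<phi>) s u \<bullet> cross3 (partial_s \<phi> s u) (partial_u \<phi> s u)
      = \<eta> s * g s u + \<mu> s * f s u"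
    unfolding phi_us[OF s] normal_fr[OF s] inner_fr[OF s]
    using sin_cos_squared_add[of "\<theta> s"] by algebra
  then show ?thesis by (simp add: f g algebra_simps)
qed

text \<open>After expansion, \<open>\<theta>' = \<eta> - \<kappa>\<close> makes the curvature terms cancel and
  \<open>\<mu> cos \<theta> = \<xi> sin \<theta>\<close> makes the mixed terms cancel. The first summand on the right is
  the one that the term \<open>- 2 F M\<close> of the mean curvature will remove.\<close>
lemma phi_ss_normal:
  assumes s: "s \<in> I"
  shows "partial_s (partial_s \<phi>) s u \<bullet> cross3 (partial_s \<phi> s u) (partial_u \<phi> s u)
    = 2 * cos (\<theta> s) * (\<mu> s * sin (\<theta> s)) - minimality_defect s u"
proof -
  define S C where "S = sin (\<theta> s)" and "C = cos (\<theta> s)"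
  \<comment> \<open>Modulo the relations below the claim is a polynomial identity.\<close>
  have SC: "S\<^sup>2 + C\<^sup>2 = 1" by (simp add: S_def C_def)
  have k: "deriv \<theta> s = \<eta> s - \<kappa> s" by (simp add: eta)
  have m: "\<mu> s = \<tau> s * S" "\<xi> s = \<tau> s * C" by (simp_all add: mu xi S_def C_def)
  show ?thesis
    unfolding minimality_defect_def phi_ss[OF s] normal_fr[OF s] inner_fr[OF s] f_s[OF s] g_s[OF s]
    unfolding f g k S_def[symmetric] C_def[symmetric] m
    using SC by algebra
qed

text \<open>The denominator is \<open>2 (E G - F\<^sup>2)\<close> times the length of the normal, the latter coming from the
  unit normal in the second fundamental form.\<close>
lemma mean_curvature_OT:
  assumes s: "s \<in> I" and reg: "regular_point \<phi> s u"
  shows "mean_curvature \<phi> s u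
    = - minimality_defect s u / (2 * ((f s u)\<^sup>2 + (g s u)\<^sup>2) * sqrt ((f s u)\<^sup>2 + (g s u)\<^sup>2))"
proof -
  let ?n = "cross3 (partial_s \<phi> s u) (partial_u \<phi> s u)"
  let ?E = "partial_s \<phi> s u \<bullet> partial_s \<phi> s u"
  have n: "norm ?n = sqrt ((f s u)\<^sup>2 + (g s u)\<^sup>2)"
    using norm_normal[OF s, of u] by (simp add: real_sqrt_unique)
  have un: "v \<bullet> unit_normal \<phi> s u = (v \<bullet> ?n) / norm ?n" for v
    by (simp add: unit_normal_def Let_def divide_inverse mult.commute)
  have W: "?E * 1 - (cos (\<theta> s))\<^sup>2 = (f s u)\<^sup>2 + (g s u)\<^sup>2"
    using norm_cross_dot[of "partial_s \<phi> s u" "partial_u \<phi> s u"]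
    unfolding norm_normal[OF s] inner_phi_s_phi_u[OF s]
    by (simp add: power_mult_distrib inner_phi_u_phi_u s flip: dot_square_norm)
  then show ?thesis
    unfolding mean_curvature_def Let_def un phi_uu inner_phi_s_phi_u[OF s] inner_phi_u_phi_u[OF s]
      phi_us_normal[OF s] phi_ss_normal[OF s] n W
    by (simp add: diff_divide_distrib)
qed

text \<open>At a singular point the normal vanishes, so \<open>f = g = 0\<close>; if \<open>\<mu> \<noteq> 0\<close> this can happen only for
  \<open>u = 0\<close>, that is on the base curve where it is tangent to the ruling, \<open>sin \<theta> = 0\<close>.\<close>
lemma minimality_defect_singular:
  assumes "s \<in> I" "\<not> regular_point \<phi> s u"
  shows "minimality_defect s u = 0"
  unfolding minimality_defect_def using assms by (auto simp: regular_iff f g mu)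

section \<open>Minimality\<close>

theorem minimal_iff:
  "minimal_on (I \<times> UNIV) \<phi> \<longleftrightarrow> (\<forall>s\<in>I. \<forall>u. minimality_defect s u = 0)"
proof -
  have "(regular_point \<phi> s u \<longrightarrow> mean_curvature \<phi> s u = 0) \<longleftrightarrow> minimality_defect s u = 0"
    if s: "s \<in> I" for s u
  proof (cases "regular_point \<phi> s u")
    case True
    then have "(f s u)\<^sup>2 + (g s u)\<^sup>2 \<noteq> 0"
      by (simp add: regular_iff s sum_power2_eq_zero_iff)
    then have "2 * ((f s u)\<^sup>2 + (g s u)\<^sup>2) * sqrt ((f s u)\<^sup>2 + (g s u)\<^sup>2) \<noteq> 0"
      by (simp only: mult_eq_0_iff real_sqrt_eq_zero_cancel_iff) simp
    with True show ?thesis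
      by (simp only: mean_curvature_OT[OF s] divide_eq_0_iff neg_equal_0_iff_equal) simp
  qed (simp add: minimality_defect_singular s)
  then show ?thesis by (auto simp: minimal_on_def)
qed

text \<open>A constant angle has \<open>\<theta>' = 0\<close>, so that \<open>\<eta> = \<kappa>\<close>, while \<open>sin \<theta> = 0\<close> gives \<open>\<mu> = g = g\<^sub>s = 0\<close>
  and \<open>f = - u \<kappa>\<close>.\<close>
lemma tangent_surface_defect:
  assumes k: "\<And>s. s \<in> I \<Longrightarrow> \<theta> s = of_int k * pi" and s: "s \<in> I"
  shows "minimality_defect s u = (u * \<kappa> s)\<^sup>2 * \<xi> s"
proof -
  have S: "sin (\<theta> s) = 0" by (simp add: k s sin_zero_iff_int2)
  have "(\<theta> has_real_derivative 0) (at s)"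
    by (rule has_field_derivative_transform_within_open[OF DERIV_const open_I s])
      (simp add: k)
  then have "deriv \<theta> s = 0" by (rule DERIV_imp_deriv)
  then show ?thesis
    unfolding minimality_defect_def g_s[OF s] mu_deriv_eq[OF s]
    by (simp add: f g mu eta S)
qed

end
theorem theorem3p13:
  fixes I :: "real set"
    and \<alpha> T N B :: "real \<Rightarrow> real^3"
    and \<kappa> \<tau> \<theta> \<eta> \<mu> \<xi> :: "real \<Rightarrow> real"
    and f g :: "real \<Rightarrow> real \<Rightarrow> real"
  assumes curve: "frenet_curve I \<alpha> T N B \<kappa> \<tau>"
    and theta: "smooth_on_open I \<theta>"
    and eta: "\<eta> = (\<lambda>s. deriv \<theta> s + \<kappa> s)"
    and mu: "\<mu> = (\<lambda>s. \<tau> s * sin (\<theta> s))"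
    and xi: "\<xi> = (\<lambda>s. \<tau> s * cos (\<theta> s))"
    and f: "f = (\<lambda>s u. sin (\<theta> s) - u * \<eta> s)"
    and g: "g = (\<lambda>s u. u * \<mu> s)"
  shows
    "(minimal_on (I \<times> UNIV) (OT_surface \<alpha> T N \<theta>) \<longleftrightarrow>
        (\<forall>s\<in>I. \<forall>u.
           ((f s u)\<^sup>2 + (g s u)\<^sup>2) * \<xi> s + \<mu> s * sin (\<theta> s) * cos (\<theta> s)
             + (g s u * deriv (\<lambda>t. f t u) s - f s u * deriv (\<lambda>t. g t u) s) = 0)) \<and>
     ((\<exists>s\<in>I. \<kappa> s \<noteq> 0 \<and> \<tau> s \<noteq> 0) \<longrightarrow>
        \<not> ((\<exists>k::int. \<forall>s\<in>I. \<theta> s = of_int k * pi) \<and>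
             minimal_on (I \<times> UNIV) (OT_surface \<alpha> T N \<theta>))) \<and>
     ((\<exists>k::int. \<forall>s\<in>I. \<theta> s = pi / 2 + of_int k * pi) \<longrightarrow>
        (minimal_on (I \<times> UNIV) (OT_surface \<alpha> T N \<theta>) \<longleftrightarrow>
           (\<forall>s\<in>I. \<forall>u. f s u * u * deriv \<mu> s - g s u * deriv (\<lambda>t. f t u) s = 0)))"
proof -
  interpret OT_ruled I \<alpha> T N B \<kappa> \<tau> \<theta> \<eta> \<mu> \<xi> f g
    using assms by unfold_locales
  have tangent: "\<not> minimal_on (I \<times> UNIV) (OT_surface \<alpha> T N \<theta>)"
    if s: "s \<in> I" "\<kappa> s \<noteq> 0" "\<tau> s \<noteq> 0" and k: "\<forall>s\<in>I. \<theta> s = of_int k * pi" for s k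
  proof
    assume "minimal_on (I \<times> UNIV) (OT_surface \<alpha> T N \<theta>)"
    \<comment> \<open>Any point off the base curve \<open>u = 0\<close>, which is the singular edge, serves here.\<close>
    then have "\<kappa> s = 0 \<or> \<xi> s = 0"
      using tangent_surface_defect[of k s 1] k s(1) by (auto simp: minimal_iff)
    moreover have "sin (\<theta> s) = 0" using k s(1) by (simp add: sin_zero_iff_int2)
    then have "cos (\<theta> s) \<noteq> 0"
      using sin_cos_squared_add[of "\<theta> s"] by auto
    ultimately show False using s by (simp add: xi)
  qed
  have normal: "minimal_on (I \<times> UNIV) (OT_surface \<alpha> T N \<theta>) \<longleftrightarrow>
      (\<forall>s\<in>I. \<forall>u. f s u * u * deriv \<mu> s - g s u * deriv (\<lambda>t. f t u) s = 0)"
    if k: "\<forall>s\<in>I. \<theta> s = pi / 2 + of_int k * pi" for k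
  proof -
    have "minimality_defect s u = - (f s u * u * deriv \<mu> s - g s u * deriv (\<lambda>t. f t u) s)"
      if s: "s \<in> I" for s u
    proof -
      have "cos (\<theta> s) = 0"
        using k s by (simp add: cos_add sin_zero_iff_int2)
      then show ?thesis unfolding minimality_defect_def g_s[OF s] by (simp add: xi)
    qed
    then show ?thesis by (auto simp: minimal_iff)
  qed
  show ?thesis
    using minimal_iff[unfolded minimality_defect_def] tangent normal by blast
qed

end
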